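(* Let $L$ be a quasi-normal modal logic contained in a quasi-normal modal logic $L'$ that has the poly-size model property and the exponential growth property. Then there exist modal formulas $\varphi_n$ and signatures $\sigma_n\subseteq\mathrm{sig}(\varphi_n)$, with $|\varphi_n|$ polynomial in $n$, such that strongest $L(\sigma_n)$-implicates of $\varphi_n$ exist and are of size at least $2^n$.
   Context: ML: modal formulas with $\top,\neg,\wedge,\Box$; $\mathrm{sig}$ = set of atoms; $|\varphi|$ = number of distinct subformulas. A pointed frame $(\mathfrak F,w)$ validates a formula if it holds at $w$ under all valuations; it validates a logic if it validates all its formulas. A quasi-normal modal logic is a set of modal formulas containing all formulas valid in all pointed frames, closed under modus ponens and uniform substitution. A frame $(W,R)$ with $w\in W$ is rooted at $w$ if every world is reachable from $w$ by an $R$-path. $L'$ has the poly-size model property if there is a polynomial $q$ such that for every formula $\varphi\notin L'$ there is a rooted frame $(\mathfrak F,w)$ validating $L'$ and refuting $\varphi$ at $w$ with at most $q(|\varphi|)$ worlds. $L'$ has the exponential growth property if there is a polynomial $f$ such that for every $n>0$ there is a rooted frame $(\mathfrak F,w)$ validating $L'$ in which at least $2^n$ worlds are reachable from $w$ by $R$-paths of length at most $f(n)$. A strongest $L(\sigma)$-implicate of $\varphi$ is a modal $\chi$ with $\mathrm{sig}(\chi)\subseteq\sigma$, $\varphi\to\chi\in L$, and $\chi\to\psi\in L$ for all $\psi$ with $\mathrm{sig}(\psi)\subseteq\sigma$ and $\varphi\to\psi\in L$. *)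

theory Defs
  imports "HOL-Computational_Algebra.Polynomial" "HOL-Library.Countable"
begin

datatype fm = Atom nat | Top | Neg fm | Conj fm fm | Box fm

instance fm :: countable
  by countable_datatype

abbreviation Imp :: "fm \<Rightarrow> fm \<Rightarrow> fm" where
  "Imp \<phi> \<psi> \<equiv> Neg (Conj \<phi> (Neg \<psi>))"

primrec sig :: "fm \<Rightarrow> nat set" where
  "sig (Atom p) = {p}"
| "sig Top = {}"
| "sig (Neg \<phi>) = sig \<phi>"
| "sig (Conj \<phi> \<psi>) = sig \<phi> \<union> sig \<psi>"
| "sig (Box \<phi>) = sig \<phi>"

primrec subformulas :: "fm \<Rightarrow> fm set" where
  "subformulas (Atom p) = {Atom p}"
| "subformulas Top = {Top}"
| "subformulas (Neg \<phi>) = insert (Neg \<phi>) (subformulas \<phi>)"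
| "subformulas (Conj \<phi> \<psi>) = insert (Conj \<phi> \<psi>) (subformulas \<phi> \<union> subformulas \<psi>)"
| "subformulas (Box \<phi>) = insert (Box \<phi>) (subformulas \<phi>)"

definition fm_size :: "fm \<Rightarrow> nat" where
  "fm_size \<phi> = card (subformulas \<phi>)"

primrec fm_subst :: "(nat \<Rightarrow> fm) \<Rightarrow> fm \<Rightarrow> fm" where
  "fm_subst s (Atom p) = s p"
| "fm_subst s Top = Top"
| "fm_subst s (Neg \<phi>) = Neg (fm_subst s \<phi>)"
| "fm_subst s (Conj \<phi> \<psi>) = Conj (fm_subst s \<phi>) (fm_subst s \<psi>)"
| "fm_subst s (Box \<phi>) = Box (fm_subst s \<phi>)"

text \<open>
  A frame is a carrier \<open>W\<close> with a relation \<open>R\<close> on it. Satisfaction does not mention \<open>W\<close>: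
  since \<open>R \<subseteq> W \<times> W\<close>, only worlds of \<open>W\<close> are visited when starting in \<open>W\<close>, and the values
  of a valuation outside \<open>W\<close> are irrelevant.
\<close>

primrec sat :: "('w \<times> 'w) set \<Rightarrow> (nat \<Rightarrow> 'w set) \<Rightarrow> 'w \<Rightarrow> fm \<Rightarrow> bool" where
  "sat R V w (Atom p) \<longleftrightarrow> w \<in> V p"
| "sat R V w Top \<longleftrightarrow> True"
| "sat R V w (Neg \<phi>) \<longleftrightarrow> \<not> sat R V w \<phi>"
| "sat R V w (Conj \<phi> \<psi>) \<longleftrightarrow> sat R V w \<phi> \<and> sat R V w \<psi>"
| "sat R V w (Box \<phi>) \<longleftrightarrow> (\<forall>v. (w, v) \<in> R \<longrightarrow> sat R V v \<phi>)"

definition pointed_frame :: "'w set \<Rightarrow> ('w \<times> 'w) set \<Rightarrow> 'w \<Rightarrow> bool" where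
  "pointed_frame W R w \<longleftrightarrow> R \<subseteq> W \<times> W \<and> w \<in> W"

definition rooted_frame :: "'w set \<Rightarrow> ('w \<times> 'w) set \<Rightarrow> 'w \<Rightarrow> bool" where
  "rooted_frame W R w \<longleftrightarrow> pointed_frame W R w \<and> (\<forall>v\<in>W. (w, v) \<in> R\<^sup>*)"

definition validates :: "('w \<times> 'w) set \<Rightarrow> 'w \<Rightarrow> fm \<Rightarrow> bool" where
  "validates R w \<phi> \<longleftrightarrow> (\<forall>V. sat R V w \<phi>)"

definition validates_logic :: "('w \<times> 'w) set \<Rightarrow> 'w \<Rightarrow> fm set \<Rightarrow> bool" where
  "validates_logic R w L \<longleftrightarrow> (\<forall>\<phi>\<in>L. validates R w \<phi>)"

text \<open>
  A definition cannot quantify over all types of worlds. Pointed frames over \<open>nat\<close> are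
  enough here: the lemma \<open>frame_valid_all_types\<close> shows that validity in them is validity
  in all pointed frames over any type.
\<close>

definition frame_valid :: "fm \<Rightarrow> bool" where
  "frame_valid \<phi> \<longleftrightarrow>
     (\<forall>(W :: nat set) R w. pointed_frame W R w \<longrightarrow> validates R w \<phi>)"

lemma frame_valid_all_types:
  fixes R :: "('w \<times> 'w) set"
  assumes "frame_valid \<phi>"
  shows "validates R w \<phi>"
  unfolding validates_def
proof
  fix V :: "nat \<Rightarrow> 'w set"
  define g where "g v \<psi> = (SOME u. (v, u) \<in> R \<and> \<not> sat R V u \<psi>)" for v \<psi>
  define h where "h a = foldl g w (from_nat a :: fm list)" for a :: nat
  define R' where "R' = {(a, b). (h a, h b) \<in> R}"
  define V' where "V' p = {a. h a \<in> V p}" for p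
  have sat_iff: "sat R' V' a \<psi> \<longleftrightarrow> sat R V (h a) \<psi>" for a \<psi>
  proof (induction \<psi> arbitrary: a)
    case (Box \<psi>)
    show ?case
    proof
      assume "sat R V (h a) (Box \<psi>)"
      then show "sat R' V' a (Box \<psi>)"
        using Box by (simp add: R'_def)
    next
      assume *: "sat R' V' a (Box \<psi>)"
      show "sat R V (h a) (Box \<psi>)"
      proof (rule ccontr)
        assume "\<not> sat R V (h a) (Box \<psi>)"
        then have "\<exists>u. (h a, u) \<in> R \<and> \<not> sat R V u \<psi>"
          by simp
        then have g: "(h a, g (h a) \<psi>) \<in> R \<and> \<not> sat R V (g (h a) \<psi>) \<psi>"
          unfolding g_def by (rule someI_ex)
        define b where "b = to_nat (from_nat a @ [\<psi>])"
        have "h b = g (h a) \<psi>"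
          by (simp add: h_def b_def)
        with g have "(a, b) \<in> R'" and "\<not> sat R V (h b) \<psi>"
          by (simp_all add: R'_def)
        with * Box.IH show False
          by simp
      qed
    qed
  qed (simp_all add: V'_def)
  have "pointed_frame UNIV R' (to_nat ([] :: fm list))"
    by (simp add: pointed_frame_def)
  with assms have "sat R' V' (to_nat ([] :: fm list)) \<phi>"
    unfolding frame_valid_def validates_def by blast
  then show "sat R V w \<phi>"
    by (simp add: sat_iff h_def)
qed

definition quasi_normal :: "fm set \<Rightarrow> bool" where
  "quasi_normal L \<longleftrightarrow>
     (\<forall>\<phi>. frame_valid \<phi> \<longrightarrow> \<phi> \<in> L) \<and>
     (\<forall>\<phi> \<psi>. \<phi> \<in> L \<longrightarrow> Imp \<phi> \<psi> \<in> L \<longrightarrow> \<psi> \<in> L) \<and>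
     (\<forall>\<phi> s. \<phi> \<in> L \<longrightarrow> fm_subst s \<phi> \<in> L)"

text \<open>
  The frames below are finite, so worlds of type \<open>nat\<close> are no restriction. As only upper
  bounds matter, neither are natural coefficients in the polynomials.
\<close>

definition poly_size_model_property :: "fm set \<Rightarrow> bool" where
  "poly_size_model_property L \<longleftrightarrow>
     (\<exists>q :: nat poly. \<forall>\<phi>. \<phi> \<notin> L \<longrightarrow>
       (\<exists>(W :: nat set) R w. rooted_frame W R w \<and> validates_logic R w L \<and>
          \<not> validates R w \<phi> \<and> finite W \<and> card W \<le> poly q (fm_size \<phi>)))"

definition reachable_within :: "('w \<times> 'w) set \<Rightarrow> 'w \<Rightarrow> nat \<Rightarrow> 'w set" where
  "reachable_within R w k = {v. \<exists>i\<le>k. (w, v) \<in> R ^^ i}"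

text \<open>
  These frames may be infinite, even uncountable, so the type of worlds is a parameter
  (frames for different \<open>n\<close> fit into one type by forming a disjoint union). The finite
  subset \<open>S\<close> expresses ``at least \<open>2 ^ n\<close>'' also when infinitely many worlds are reachable.
\<close>

definition exponential_growth_property :: "'w itself \<Rightarrow> fm set \<Rightarrow> bool" where
  "exponential_growth_property (_ :: 'w itself) L \<longleftrightarrow>
     (\<exists>f :: nat poly. \<forall>n>0.
       (\<exists>(W :: 'w set) R w. rooted_frame W R w \<and> validates_logic R w L \<and>
          (\<exists>S \<subseteq> reachable_within R w (poly f n). finite S \<and> 2 ^ n \<le> card S)))"

definition strongest_implicate :: "fm set \<Rightarrow> nat set \<Rightarrow> fm \<Rightarrow> fm \<Rightarrow> bool" where
  "strongest_implicate L \<sigma> \<phi> \<chi> \<longleftrightarrow>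
     sig \<chi> \<subseteq> \<sigma> \<and> Imp \<phi> \<chi> \<in> L \<and>
     (\<forall>\<psi>. sig \<psi> \<subseteq> \<sigma> \<longrightarrow> Imp \<phi> \<psi> \<in> L \<longrightarrow> Imp \<chi> \<psi> \<in> L)"

end

theory Submission
  imports Defs
begin

text \<open>
  With atoms \<open>p\<^sub>i\<close> and \<open>s\<^sub>i\<close>, \<open>i < m\<close>, let \<open>\<phi>\<close> say that each \<open>s\<^sub>i\<close> is constant on the worlds
  reachable within \<open>k\<close> steps and that none of these worlds satisfies all \<open>p\<^sub>i \<leftrightarrow> s\<^sub>i\<close>. Let \<open>\<sigma>\<close>
  consist of the \<open>p\<^sub>i\<close>. Substituting truth constants for the \<open>s\<^sub>i\<close> shows that, in any
  quasi-normal logic, a strongest implicate of \<open>\<phi>\<close> is the (exponentially long) formula stating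
  that some subset of \<open>{..<m}\<close> is not realised by the \<open>p\<^sub>i\<close> within \<open>k\<close> steps. Exponential
  growth makes this formula refutable in a frame for \<open>L'\<close>, and any refuting frame has at least
  \<open>2 ^ m\<close> worlds. As all strongest implicates are equivalent in \<open>L\<close>, the poly-size model
  property bounds the size of each of them from below.
\<close>

section \<open>Semantics and quasi-normal logics\<close>

lemma sat_fm_subst:
  "sat R V w (fm_subst s \<phi>) \<longleftrightarrow> sat R (\<lambda>p. {v. sat R V v (s p)}) w \<phi>"
  by (induction \<phi> arbitrary: w) auto

lemma fm_subst_ident:
  assumes "\<And>p. p \<in> sig \<phi> \<Longrightarrow> s p = Atom p"
  shows "fm_subst s \<phi> = \<phi>"
  using assms by (induction \<phi>) auto

text \<open>Moving the premises one by one into antecedents leaves a frame-valid formula, and modus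
  ponens discharges them again. Membership in \<open>L\<close> can thus be shown semantically; the
  consequence is local because quasi-normal logics need not be closed under
  \<open>Box\<close>.\<close>

lemma quasi_normal_local_consequence:
  assumes L: "quasi_normal L"
    and "set \<Gamma> \<subseteq> L"
    and "\<And>(R :: (nat \<times> nat) set) V w. (\<And>\<gamma>. \<gamma> \<in> set \<Gamma> \<Longrightarrow> sat R V w \<gamma>) \<Longrightarrow> sat R V w \<theta>"
  shows "\<theta> \<in> L"
  using assms(2,3)
proof (induction \<Gamma> arbitrary: \<theta>)
  case Nil
  then have "frame_valid \<theta>"
    by (auto simp: frame_valid_def validates_def)
  with L show ?case
    by (simp add: quasi_normal_def)
next
  case (Cons \<gamma> \<Gamma>)
  have "Imp \<gamma> \<theta> \<in> L"
  proof (rule Cons.IH)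
    show "set \<Gamma> \<subseteq> L"
      using Cons.prems(1) by simp
    show "sat R V w (Imp \<gamma> \<theta>)" if "\<And>\<delta>. \<delta> \<in> set \<Gamma> \<Longrightarrow> sat R V w \<delta>"
      for R :: "(nat \<times> nat) set" and V w
      using Cons.prems(2)[of R V w] that by auto
  qed
  moreover have "\<gamma> \<in> L"
    using Cons.prems(1) by simp
  ultimately show ?case
    using L unfolding quasi_normal_def by blast
qed

lemma relpow_Suc_left: "(w, v) \<in> R ^^ Suc i \<longleftrightarrow> (\<exists>u. (w, u) \<in> R \<and> (u, v) \<in> R ^^ i)"
  by (meson relpow_Suc_D2 relpow_Suc_I2)

lemma reachable_within_0: "reachable_within R w 0 = {w}"
  by (auto simp: reachable_within_def)

text \<open>Splits off the first step of a path, which is how \<open>Box_le\<close> recurses;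
  \<open>w\<close> itself accounts for the path of length zero.\<close>

lemma reachable_within_Suc:
  "reachable_within R w (Suc k) = insert w (\<Union>u\<in>{u. (w, u) \<in> R}. reachable_within R u k)"
proof (rule set_eqI)
  fix v
  have "v \<in> reachable_within R w (Suc k) \<longleftrightarrow>
      (w, v) \<in> R ^^ 0 \<or> (\<exists>i\<le>k. (w, v) \<in> R ^^ Suc i)"
    unfolding reachable_within_def mem_Collect_eq
    by (metis Suc_le_mono le0 not0_implies_Suc)
  then show "v \<in> reachable_within R w (Suc k) \<longleftrightarrow>
      v \<in> insert w (\<Union>u\<in>{u. (w, u) \<in> R}. reachable_within R u k)"
    unfolding relpow_Suc_left by (auto simp: reachable_within_def)
qed

lemma reachable_within_subset:
  assumes "pointed_frame W R w"
  shows "reachable_within R w k \<subseteq> W"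
proof -
  have "reachable_within R w k \<subseteq> W" if "w \<in> W" "R \<subseteq> W \<times> W" for w
    using that
    by (induction k arbitrary: w) (auto simp: reachable_within_0 reachable_within_Suc)
  with assms show ?thesis
    by (simp add: pointed_frame_def)
qed

section \<open>The formulas\<close>

abbreviation Disj :: "fm \<Rightarrow> fm \<Rightarrow> fm" where
  "Disj \<phi> \<psi> \<equiv> Neg (Conj (Neg \<phi>) (Neg \<psi>))"

abbreviation Iff :: "fm \<Rightarrow> fm \<Rightarrow> fm" where
  "Iff \<phi> \<psi> \<equiv> Conj (Imp \<phi> \<psi>) (Imp \<psi> \<phi>)"

primrec Conjs :: "fm list \<Rightarrow> fm" where
  "Conjs [] = Top"
| "Conjs (\<phi> # \<phi>s) = Conj \<phi> (Conjs \<phi>s)"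

text \<open>The nesting reuses the previous level, so that each level adds at most two
  subformulas.\<close>

primrec Box_le :: "nat \<Rightarrow> fm \<Rightarrow> fm" where
  "Box_le 0 \<phi> = \<phi>"
| "Box_le (Suc k) \<phi> = Conj \<phi> (Box (Box_le k \<phi>))"

lemma sat_Conjs: "sat R V w (Conjs \<phi>s) \<longleftrightarrow> (\<forall>\<phi>\<in>set \<phi>s. sat R V w \<phi>)"
  by (induction \<phi>s) auto

lemma sig_Conjs: "sig (Conjs \<phi>s) = (\<Union>\<phi>\<in>set \<phi>s. sig \<phi>)"
  by (induction \<phi>s) auto

lemma sat_Box_le: "sat R V w (Box_le k \<phi>) \<longleftrightarrow> (\<forall>v\<in>reachable_within R w k. sat R V v \<phi>)"
  by (induction k arbitrary: w) (auto simp: reachable_within_0 reachable_within_Suc)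

lemma sig_Box_le: "sig (Box_le k \<phi>) = sig \<phi>"
  by (induction k) auto

text \<open>The parameter \<open>t\<close> stands for the atoms \<open>Atom (m + i)\<close> in
  \<open>hidden_mismatch\<close> and for truth constants in \<open>some_mismatch\<close>.\<close>

definition mismatch :: "nat \<Rightarrow> nat \<Rightarrow> (nat \<Rightarrow> fm) \<Rightarrow> fm" where
  "mismatch m k t = Box_le k (Neg (Conjs (map (\<lambda>i. Iff (Atom i) (t i)) [0..<m])))"

definition uniform :: "nat \<Rightarrow> nat \<Rightarrow> fm" where
  "uniform m k =
     Conjs (map (\<lambda>i. Disj (Box_le k (Atom (m + i))) (Box_le k (Neg (Atom (m + i))))) [0..<m])"

text \<open>Atoms \<open>i < m\<close> are the \<open>p\<^sub>i\<close>, and atom \<open>m + i\<close> is \<open>s\<^sub>i\<close>.\<close>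

definition hidden_mismatch :: "nat \<Rightarrow> nat \<Rightarrow> fm" where
  "hidden_mismatch m k = Conj (mismatch m k (\<lambda>i. Atom (m + i))) (uniform m k)"

definition truth :: "bool \<Rightarrow> fm" where
  "truth b = (if b then Top else Neg Top)"

text \<open>\<open>Conjs\<close> takes a list, so \<open>subseqs\<close> supplies the subsets of
  \<open>{..<m}\<close> as lists; the two layers of negation yield a disjunction.\<close>

definition some_mismatch :: "nat \<Rightarrow> nat \<Rightarrow> fm" where
  "some_mismatch m k =
     Neg (Conjs (map (\<lambda>xs. Neg (mismatch m k (\<lambda>i. truth (i \<in> set xs)))) (subseqs [0..<m])))"

lemma sat_truth [simp]: "sat R V w (truth b) \<longleftrightarrow> b"
  by (simp add: truth_def)

lemma sig_truth [simp]: "sig (truth b) = {}"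
  by (simp add: truth_def)

lemma sat_mismatch:
  "sat R V w (mismatch m k t) \<longleftrightarrow>
     (\<forall>v\<in>reachable_within R w k. \<exists>i<m. (v \<in> V i) \<noteq> sat R V v (t i))"
  unfolding mismatch_def sat_Box_le by (rule ball_cong) (auto simp: sat_Conjs)

lemma sat_uniform:
  "sat R V w (uniform m k) \<longleftrightarrow>
     (\<forall>i<m. reachable_within R w k \<subseteq> V (m + i) \<or> reachable_within R w k \<inter> V (m + i) = {})"
  by (auto simp: uniform_def sat_Box_le sat_Conjs)

lemma sat_some_mismatch_Pow:
  "sat R V w (some_mismatch m k) \<longleftrightarrow>
     (\<exists>A\<in>Pow {..<m}. sat R V w (mismatch m k (\<lambda>i. truth (i \<in> A))))"
proof -
  have "Pow {..<m} = set ` set (subseqs [0..<m])"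
    by (simp add: subseqs_powset lessThan_atLeast0)
  then show ?thesis
    by (simp add: some_mismatch_def sat_Conjs)
qed

text \<open>The form used for counting: refuting the formula means that the sets
  \<open>{i. i < m \<and> v \<in> V i}\<close> of reachable worlds \<open>v\<close> exhaust
  \<open>Pow {..<m}\<close>.\<close>

lemma sat_some_mismatch:
  "sat R V w (some_mismatch m k) \<longleftrightarrow>
     (\<exists>A\<in>Pow {..<m}. \<forall>v\<in>reachable_within R w k. {i. i < m \<and> v \<in> V i} \<noteq> A)"
proof -
  have "(\<exists>i<m. (v \<in> V i) \<noteq> (i \<in> A)) \<longleftrightarrow> {i. i < m \<and> v \<in> V i} \<noteq> A"
    if "A \<in> Pow {..<m}" for v A
    using that by blast
  then show ?thesis
    unfolding sat_some_mismatch_Pow sat_mismatch sat_truth by simp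
qed

lemma sig_mismatch: "sig (mismatch m k t) = {..<m} \<union> (\<Union>i<m. sig (t i))"
  by (auto simp: mismatch_def sig_Box_le sig_Conjs)

lemma sig_some_mismatch: "sig (some_mismatch m k) \<subseteq> {..<m}"
  by (auto simp: some_mismatch_def sig_Conjs sig_mismatch)

section \<open>The strongest implicate\<close>

lemma hidden_mismatch_implies_some_mismatch:
  assumes "sat R V w (hidden_mismatch m k)"
  shows "sat R V w (some_mismatch m k)"
proof -
  \<comment> \<open>By uniformity the atoms \<open>m + i\<close> have the same value at all worlds
    within \<open>k\<close> steps, so the set they encode can be read off at
    \<open>w\<close>.\<close>
  define A where "A = {i. i < m \<and> w \<in> V (m + i)}"
  have w: "w \<in> reachable_within R w k"
    by (auto simp: reachable_within_def intro: exI[of _ 0])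
  have "v \<in> V (m + i) \<longleftrightarrow> i \<in> A" if "v \<in> reachable_within R w k" "i < m" for v i
    using assms that w unfolding hidden_mismatch_def sat.simps sat_uniform A_def by blast
  then have "sat R V w (mismatch m k (\<lambda>i. truth (i \<in> A)))"
    using assms by (simp add: hidden_mismatch_def sat_mismatch) blast
  moreover have "A \<in> Pow {..<m}"
    by (auto simp: A_def)
  ultimately show ?thesis
    unfolding sat_some_mismatch_Pow by blast
qed

text \<open>Truth constants do not vary between worlds, so the substitution makes
  \<open>uniform\<close> true and only the mismatch remains.\<close>

lemma sat_subst_hidden_mismatch:
  assumes "\<And>i. i < m \<Longrightarrow> s i = Atom i"
    and "\<And>i. i < m \<Longrightarrow> s (m + i) = truth (i \<in> A)"
  shows "sat R V w (fm_subst s (hidden_mismatch m k)) \<longleftrightarrow>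
    sat R V w (mismatch m k (\<lambda>i. truth (i \<in> A)))"
  using assms
  by (auto simp: sat_fm_subst hidden_mismatch_def sat_mismatch sat_uniform cong: conj_cong)

text \<open>Each disjunct is equivalent to a substitution instance of
  \<open>hidden_mismatch\<close>. The same substitution fixes every \<psi> over
  \<open>{..<m}\<close>, so \<open>L\<close> contains the implication from that instance to \<psi>;
  these finitely many implications together cover the disjunction.\<close>

lemma strongest_implicate_some_mismatch:
  assumes L: "quasi_normal L"
  shows "strongest_implicate L {..<m} (hidden_mismatch m k) (some_mismatch m k)"
  unfolding strongest_implicate_def
proof (intro conjI allI impI)
  show "sig (some_mismatch m k) \<subseteq> {..<m}"
    by (rule sig_some_mismatch)
  show "Imp (hidden_mismatch m k) (some_mismatch m k) \<in> L"
    by (rule quasi_normal_local_consequence[OF L, of "[]"])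
      (auto dest: hidden_mismatch_implies_some_mismatch)
next
  fix \<psi>
  assume \<psi>: "sig \<psi> \<subseteq> {..<m}" and imp: "Imp (hidden_mismatch m k) \<psi> \<in> L"
  define s where "s A j = (if j < m then Atom j else truth (j - m \<in> A))" for A j
  have [simp]: "fm_subst (s A) \<psi> = \<psi>" for A
    using \<psi> by (intro fm_subst_ident) (auto simp: s_def)
  have sat_s: "sat R V w (fm_subst (s A) (hidden_mismatch m k)) \<longleftrightarrow>
      sat R V w (mismatch m k (\<lambda>i. truth (i \<in> A)))"
    for R :: "(nat \<times> nat) set" and V w A
    by (rule sat_subst_hidden_mismatch) (auto simp: s_def)
  obtain As where As: "set As = Pow {..<m}"
    using finite_list[of "Pow {..<m}"] by auto
  define \<Gamma> where "\<Gamma> = map (\<lambda>A. fm_subst (s A) (Imp (hidden_mismatch m k) \<psi>)) As"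
  show "Imp (some_mismatch m k) \<psi> \<in> L"
  proof (rule quasi_normal_local_consequence[OF L])
    have "fm_subst (s A) (Imp (hidden_mismatch m k) \<psi>) \<in> L" for A
      using L imp unfolding quasi_normal_def by blast
    then show "set \<Gamma> \<subseteq> L"
      unfolding \<Gamma>_def by (simp only: set_map) blast
  next
    fix R :: "(nat \<times> nat) set" and V w
    assume \<Gamma>: "\<And>\<gamma>. \<gamma> \<in> set \<Gamma> \<Longrightarrow> sat R V w \<gamma>"
    have "sat R V w (fm_subst (s A) (Imp (hidden_mismatch m k) \<psi>))" if "A \<in> Pow {..<m}" for A
      using that by (intro \<Gamma>) (unfold \<Gamma>_def set_map As, rule imageI)
    then show "sat R V w (Imp (some_mismatch m k) \<psi>)"
      by (auto simp: sat_some_mismatch_Pow sat_s)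
  qed
qed

text \<open>Used in both directions, this makes all strongest implicates of a formula equivalent in
  \<open>L\<close>.\<close>

lemma strongest_implicates_imp:
  assumes "strongest_implicate L \<sigma> \<phi> \<chi>" "strongest_implicate L \<sigma> \<phi> \<chi>'"
  shows "Imp \<chi> \<chi>' \<in> L"
  using assms unfolding strongest_implicate_def by blast

section \<open>Refuting frames\<close>

lemma some_mismatch_refutable:
  assumes "S \<subseteq> reachable_within R w k" "finite S" "2 ^ m \<le> card S"
  shows "\<not> validates R w (some_mismatch m k)"
proof -
  have "card (Pow {..<m}) \<le> card S"
    using assms(3) by (simp add: card_Pow)
  then obtain g where g: "g ` Pow {..<m} \<subseteq> S" "inj_on g (Pow {..<m})"
    using card_le_inj[OF _ assms(2), of "Pow {..<m}"] by auto
  \<comment> \<open>The world \<open>g A\<close> is to realise exactly \<open>A\<close>; injectivity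
    of \<open>g\<close> excludes conflicts.\<close>
  define V where "V i = g ` {A \<in> Pow {..<m}. i \<in> A}" for i
  have "{i. i < m \<and> g A \<in> V i} = A" if "A \<in> Pow {..<m}" for A
  proof -
    have "g A \<in> V i \<longleftrightarrow> i \<in> A" for i
      unfolding V_def using that by (subst inj_on_image_mem_iff[OF g(2)]) auto
    with that show ?thesis
      by auto
  qed
  moreover have "g A \<in> reachable_within R w k" if "A \<in> Pow {..<m}" for A
    using that g(1) assms(1) by auto
  ultimately have "\<not> sat R V w (some_mismatch m k)"
    unfolding sat_some_mismatch by blast
  then show ?thesis
    by (auto simp: validates_def)
qed

text \<open>A refuting valuation realises every subset of \<open>{..<m}\<close> at some reachable
  world, and a world realises only one subset.\<close>

lemma card_refuting_frame:
  assumes "pointed_frame W R w" "finite W" "\<not> validates R w (some_mismatch m k)"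
  shows "2 ^ m \<le> card W"
proof -
  obtain V where V: "\<not> sat R V w (some_mismatch m k)"
    using assms(3) by (auto simp: validates_def)
  have "Pow {..<m} \<subseteq> (\<lambda>v. {i. i < m \<and> v \<in> V i}) ` reachable_within R w k"
  proof
    fix A
    assume "A \<in> Pow {..<m}"
    with V obtain v where v: "v \<in> reachable_within R w k" "{i. i < m \<and> v \<in> V i} = A"
      unfolding sat_some_mismatch by meson
    show "A \<in> (\<lambda>v. {i. i < m \<and> v \<in> V i}) ` reachable_within R w k"
      unfolding v(2)[symmetric] using v(1) by (rule imageI)
  qed
  also have "\<dots> \<subseteq> (\<lambda>v. {i. i < m \<and> v \<in> V i}) ` W"
    using reachable_within_subset[OF assms(1)] by (rule image_mono)
  finally have "card (Pow {..<m}) \<le> card W"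
    by (rule surj_card_le[OF assms(2)])
  then show ?thesis
    by (simp add: card_Pow)
qed

section \<open>Size bounds\<close>

lemma finite_subformulas: "finite (subformulas \<phi>)"
  by (induction \<phi>) auto

lemma fm_size_Atom: "fm_size (Atom p) = 1"
  by (simp add: fm_size_def)

lemma fm_size_Top: "fm_size Top = 1"
  by (simp add: fm_size_def)

lemma fm_size_Neg: "fm_size (Neg \<phi>) \<le> Suc (fm_size \<phi>)"
  by (simp add: fm_size_def card_insert_le_m1 finite_subformulas card_insert_if)

lemma fm_size_Conj: "fm_size (Conj \<phi> \<psi>) \<le> Suc (fm_size \<phi> + fm_size \<psi>)"
  using card_Un_le[of "subformulas \<phi>" "subformulas \<psi>"]
  by (simp add: fm_size_def finite_subformulas card_insert_if)

lemma fm_size_Conjs: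
  assumes "\<And>\<phi>. \<phi> \<in> set \<phi>s \<Longrightarrow> fm_size \<phi> \<le> b"
  shows "fm_size (Conjs \<phi>s) \<le> 1 + length \<phi>s * Suc b"
  using assms
proof (induction \<phi>s)
  case Nil
  show ?case
    by (simp add: fm_size_Top)
next
  case (Cons \<phi> \<phi>s)
  have "fm_size \<phi> \<le> b" "fm_size (Conjs \<phi>s) \<le> 1 + length \<phi>s * Suc b"
    using Cons by auto
  with fm_size_Conj[of \<phi> "Conjs \<phi>s"] show ?case
    by simp
qed

lemma fm_size_Box_le: "fm_size (Box_le k \<phi>) \<le> fm_size \<phi> + 2 * k"
proof -
  \<comment> \<open>The inclusion strengthens the induction: it shows that the outer conjunct \<phi>
    contributes no new subformulas.\<close>
  have "card (subformulas (Box_le k \<phi>)) \<le> card (subformulas \<phi>) + 2 * k \<and>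
      subformulas \<phi> \<subseteq> subformulas (Box_le k \<phi>)"
  proof (induction k)
    case (Suc k)
    then have "subformulas \<phi> \<union> insert (Box (Box_le k \<phi>)) (subformulas (Box_le k \<phi>)) =
        insert (Box (Box_le k \<phi>)) (subformulas (Box_le k \<phi>))"
      by auto
    with Suc show ?case
      by (simp add: finite_subformulas card_insert_if) blast
  qed simp
  then show ?thesis
    by (simp add: fm_size_def)
qed

lemma fm_size_Disj: "fm_size (Disj \<phi> \<psi>) \<le> fm_size \<phi> + fm_size \<psi> + 4"
  using fm_size_Neg[of \<phi>] fm_size_Neg[of \<psi>] fm_size_Conj[of "Neg \<phi>" "Neg \<psi>"]
    fm_size_Neg[of "Conj (Neg \<phi>) (Neg \<psi>)"] by linarith

lemma fm_size_Imp: "fm_size (Imp \<phi> \<psi>) \<le> fm_size \<phi> + fm_size \<psi> + 3"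
  using fm_size_Neg[of \<psi>] fm_size_Conj[of \<phi> "Neg \<psi>"] fm_size_Neg[of "Conj \<phi> (Neg \<psi>)"]
  by linarith

lemma fm_size_Iff_Atom: "fm_size (Iff (Atom i) (Atom j)) \<le> 11"
  using fm_size_Imp[of "Atom i" "Atom j"] fm_size_Imp[of "Atom j" "Atom i"]
    fm_size_Conj[of "Imp (Atom i) (Atom j)" "Imp (Atom j) (Atom i)"]
  by (simp only: fm_size_Atom)

lemma fm_size_hidden_mismatch:
  "fm_size (hidden_mismatch m k) \<le> 4 + 20 * m + 2 * k + 4 * m * k"
proof -
  let ?c = "Conjs (map (\<lambda>i. Iff (Atom i) (Atom (m + i))) [0..<m])"
  have "fm_size ?c \<le> 1 + 12 * m"
    by (rule order_trans[OF fm_size_Conjs[where b = 11]]) (auto intro: fm_size_Iff_Atom)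
  then have "fm_size (mismatch m k (\<lambda>i. Atom (m + i))) \<le> 2 + 12 * m + 2 * k"
    using fm_size_Box_le[of k "Neg ?c"] fm_size_Neg[of ?c] unfolding mismatch_def by linarith
  moreover
  have disj: "fm_size (Disj (Box_le k (Atom j)) (Box_le k (Neg (Atom j)))) \<le> 7 + 4 * k" for j
    using fm_size_Box_le[of k "Atom j"] fm_size_Box_le[of k "Neg (Atom j)"]
      fm_size_Neg[of "Atom j"] fm_size_Atom[of j]
      fm_size_Disj[of "Box_le k (Atom j)" "Box_le k (Neg (Atom j))"]
    by linarith
  have "fm_size (uniform m k) \<le> 1 + m * Suc (7 + 4 * k)"
    unfolding uniform_def by (rule order_trans[OF fm_size_Conjs[where b = "7 + 4 * k"]]) (use disj in auto)
  ultimately show ?thesis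
    using fm_size_Conj[of "mismatch m k (\<lambda>i. Atom (m + i))" "uniform m k"]
    unfolding hidden_mismatch_def by (simp add: algebra_simps)
qed

lemma poly_nat_mono:
  fixes q :: "nat poly"
  assumes "x \<le> y"
  shows "poly q x \<le> poly q y"
  using assms by (induction q) (auto intro: mult_le_mono)

text \<open>The exponent is linear in \<open>n\<close>, so a number of atoms linear in
  \<open>n\<close> suffices to exceed \<open>poly q (2 ^ n)\<close> worlds.\<close>

lemma poly_nat_power2_bound:
  fixes q :: "nat poly"
  obtains c d where "\<And>n. poly q (2 ^ n) \<le> 2 ^ (c + d * n)"
proof -
  have "\<exists>c d. \<forall>n. poly q (2 ^ n) \<le> 2 ^ (c + d * n)"
  proof (induction q)
    case (pCons a q)
    then obtain c d where cd: "\<And>n. poly q (2 ^ n) \<le> 2 ^ (c + d * n)"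
      by blast
    \<comment> \<open>Both summands are at most \<open>2 ^ (a + c + Suc d * n)\<close>; the outer
      \<open>Suc\<close> pays for adding them.\<close>
    have "poly (pCons a q) (2 ^ n) \<le> 2 ^ (Suc (a + c) + Suc d * n)" for n
    proof -
      have "a \<le> 2 ^ a"
        by (simp add: less_imp_le)
      also have "\<dots> \<le> (2::nat) ^ (a + c + Suc d * n)"
        by (intro power_increasing) auto
      finally have a: "a \<le> 2 ^ (a + c + Suc d * n)" .
      have "2 ^ n * poly q (2 ^ n) \<le> 2 ^ n * 2 ^ (c + d * n)"
        using cd by (intro mult_le_mono2)
      also have "\<dots> = (2::nat) ^ (c + Suc d * n)"
        by (simp add: power_add)
      also have "\<dots> \<le> 2 ^ (a + c + Suc d * n)"
        by (intro power_increasing) auto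
      finally show ?thesis
        using a
        by simp
    qed
    then show ?case
      by blast
  qed simp
  with that show ?thesis
    by blast
qed

theorem theorem6p1:
  fixes L L' :: "fm set"
  assumes "quasi_normal L"
    and "quasi_normal L'"
    and "L \<subseteq> L'"
    and "poly_size_model_property L'"
    and "exponential_growth_property TYPE('w) L'"
  shows "\<exists>(\<phi> :: nat \<Rightarrow> fm) (\<sigma> :: nat \<Rightarrow> nat set) (p :: nat poly). \<forall>n.
    \<sigma> n \<subseteq> sig (\<phi> n) \<and>
    fm_size (\<phi> n) \<le> poly p n \<and>
    (\<exists>\<chi>. strongest_implicate L (\<sigma> n) (\<phi> n) \<chi>) \<and>
    (\<forall>\<chi>. strongest_implicate L (\<sigma> n) (\<phi> n) \<chi> \<longrightarrow> 2 ^ n \<le> fm_size \<chi>)"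
proof -
  obtain q :: "nat poly" where q: "\<And>\<phi>. \<phi> \<notin> L' \<Longrightarrow>
      \<exists>(W :: nat set) R w. rooted_frame W R w \<and> validates_logic R w L' \<and>
        \<not> validates R w \<phi> \<and> finite W \<and> card W \<le> poly q (fm_size \<phi>)"
    using assms(4) unfolding poly_size_model_property_def by blast
  obtain f :: "nat poly" where f: "\<And>n. n > 0 \<Longrightarrow>
      \<exists>(W :: 'w set) R w. rooted_frame W R w \<and> validates_logic R w L' \<and>
        (\<exists>S \<subseteq> reachable_within R w (poly f n). finite S \<and> 2 ^ n \<le> card S)"
    using assms(5) unfolding exponential_growth_property_def by blast
  obtain c d where cd: "\<And>n. poly q (2 ^ n) \<le> 2 ^ (c + d * n)"
    using poly_nat_power2_bound[of q] by blast
  \<comment> \<open>One more than the exponent bounding \<open>poly q (2 ^ n)\<close>: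
    \<open>2 ^ m n\<close> then strictly exceeds that bound, and \<open>m n\<close> is positive even
    for \<open>n = 0\<close>, as the growth property requires.\<close>
  define M :: "nat poly" where "M = [:Suc c, d:]"
  define m where "m n = poly M n" for n
  \<comment> \<open>At this depth the growth property for \<open>m n\<close> provides at least
    \<open>2 ^ m n\<close> worlds.\<close>
  define k where "k n = poly f (m n)" for n
  define p where "p = 4 + 20 * M + 2 * pcompose f M + 4 * M * pcompose f M"
  have m: "m n = Suc (c + d * n)" for n
    by (simp add: m_def M_def)
  have sig: "{..<m n} \<subseteq> sig (hidden_mismatch (m n) (k n))" for n
    by (auto simp: hidden_mismatch_def sig_mismatch)
  have size: "fm_size (hidden_mismatch (m n) (k n)) \<le> poly p n" for n
    using fm_size_hidden_mismatch[of "m n" "k n"]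
    by (simp add: p_def poly_pcompose m_def k_def)
  have ex: "strongest_implicate L {..<m n} (hidden_mismatch (m n) (k n))
      (some_mismatch (m n) (k n))" for n
    using assms(1) by (rule strongest_implicate_some_mismatch)
  have large: "2 ^ n \<le> fm_size \<chi>"
    if \<chi>: "strongest_implicate L {..<m n} (hidden_mismatch (m n) (k n)) \<chi>" for n \<chi>
  proof -
    let ?\<chi>\<^sub>0 = "some_mismatch (m n) (k n)"
    \<comment> \<open>Equivalence in \<open>L\<close> passes to \<open>L'\<close>, so that frames
      for \<open>L'\<close> can be used. One direction shows that \<chi> is outside
      \<open>L'\<close>, the other turns a refutation of \<chi> into one of
      \<open>some_mismatch\<close>.\<close>
    have imps: "Imp ?\<chi>\<^sub>0 \<chi> \<in> L'" "Imp \<chi> ?\<chi>\<^sub>0 \<in> L'"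
      using strongest_implicates_imp[OF ex \<chi>] strongest_implicates_imp[OF \<chi> ex] assms(3)
      by auto
    obtain R :: "('w \<times> 'w) set" and w S where R: "validates_logic R w L'"
      and S: "S \<subseteq> reachable_within R w (k n)" "finite S" "2 ^ m n \<le> card S"
      using f[of "m n"] m[of n] unfolding k_def by fastforce
    have "?\<chi>\<^sub>0 \<notin> L'"
      using some_mismatch_refutable[OF S] R unfolding validates_logic_def by blast
    then have "\<chi> \<notin> L'"
      using imps(2) assms(2) unfolding quasi_normal_def by blast
    from q[OF this] obtain W :: "nat set" and R w
      where W: "rooted_frame W R w" "validates_logic R w L'" "\<not> validates R w \<chi>"
        "finite W" "card W \<le> poly q (fm_size \<chi>)"
      by blast
    have "validates R w (Imp ?\<chi>\<^sub>0 \<chi>)"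
      using W(2) imps(1) by (simp add: validates_logic_def)
    then have "\<not> validates R w ?\<chi>\<^sub>0"
      using W(3) by (auto simp: validates_def)
    then have "2 ^ m n \<le> card W"
      using W(1,4) by (intro card_refuting_frame) (auto simp: rooted_frame_def)
    then have *: "2 ^ m n \<le> poly q (fm_size \<chi>)"
      using W(5) by linarith
    show ?thesis
    proof (rule ccontr)
      assume "\<not> 2 ^ n \<le> fm_size \<chi>"
      then have "poly q (fm_size \<chi>) \<le> 2 ^ (c + d * n)"
        using poly_nat_mono[of "fm_size \<chi>" "2 ^ n" q] cd[of n] by linarith
      also have "\<dots> < 2 ^ m n"
        by (simp add: m)
      finally show False
        using * by simp
    qed
  qed
  show ?thesis
    using sig size ex large
    by (intro exI[of _ "\<lambda>n. hidden_mismatch (m n) (k n)"] exI[of _ "\<lambda>n. {..<m n}"]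
        exI[of _ p] allI conjI impI exI[of _ "some_mismatch (m n) (k n)" for n])
qed

end
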